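(* Let $(X,\widehat d_X)$ be a compact non-Archimedean metric space, and let $K$ be a complete non-Archimedean valued field with absolute value $|\cdot|$, such that every ball in $X$ and every ball in $K$ contains at least two distinct points. Then $\widehat D_{X,K}$ is a non-Archimedean metric on $\mathrm{MEA}(X\to K)$.
   Context: A non-Archimedean metric satisfies $\widehat d(x,z)\le\max\{\widehat d(x,y),\widehat d(y,z)\}$. A ball in a non-Archimedean metric space is a set $\{x:\widehat d(a,x)<r\}$ or $\{x:\widehat d(a,x)\le r\}$ with $0<r<\infty$ ($K$ carries the metric $|\alpha-\beta|$). $\mathfrak C(X\to K)$ is the $K$-vector space of continuous functions $X\to K$ with the supremum norm $\|f\|_\infty=\sup_{x\in X}|f(x)|$. A $K$-valued measure on $X$ is a $K$-linear functional $\mu:\mathfrak C(X\to K)\to K$ for which there is $M\ge0$ with $|\mu(f)|\le M\|f\|_\infty$ for all $f$; one writes $\int_X f\,d\mu=\mu(f)$. $\mathrm{MEA}(X\to K)$ is the set of all $K$-valued measures on $X$. For $f:X\to K$, $\operatorname{dil}(f)=\sup_{x_1\ne x_2}\frac{|f(x_1)-f(x_2)|}{\widehat d_X(x_1,x_2)}$ and $\|f\|_{\widehat{BL}}=\max\{\|f\|_\infty,\operatorname{dil}(f)\}\in[0,\infty]$. For $\mu_1,\mu_2\in\mathrm{MEA}(X\to K)$, $$\widehat D_{X,K}(\mu_1,\mu_2)=\sup\Big\{\Big|\int_X f\,d\mu_1-\int_X f\,d\mu_2\Big|:\ f\in\mathfrak C(X\to K),\ \|f\|_{\widehat{BL}}\le1\Big\}.$$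 *)

theory Defs
  imports "HOL-Analysis.Analysis"
begin

locale nonarch_metric_space = Metric_space M d
  for M :: "'a set" and d :: "'a \<Rightarrow> 'a \<Rightarrow> real" +
  assumes strong_triangle: "\<lbrakk>x \<in> M; y \<in> M; z \<in> M\<rbrakk> \<Longrightarrow> d x z \<le> max (d x y) (d y z)"

locale nonarch_valued_field =
  fixes v :: "'k::field \<Rightarrow> real"
  assumes abs_nonneg: "0 \<le> v a"
    and abs_eq_0_iff: "v a = 0 \<longleftrightarrow> a = 0"
    and abs_mult: "v (a * b) = v a * v b"
    and abs_add_le_max: "v (a + b) \<le> max (v a) (v b)"

definition abs_dist :: "('k::field \<Rightarrow> real) \<Rightarrow> 'k \<Rightarrow> 'k \<Rightarrow> real" where
  "abs_dist v a b = v (a - b)"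

lemma (in nonarch_valued_field) nonarch_metric_space_abs_dist:
  "nonarch_metric_space UNIV (abs_dist v)"
proof -
  have "v 1 * v 1 = v 1" using abs_mult[of 1 1] by simp
  moreover have "v 1 \<noteq> 0" by (simp add: abs_eq_0_iff)
  ultimately have one: "v 1 = 1" by simp
  have "v (-1) * v (-1) = 1" using abs_mult[of "-1" "-1"] one by simp
  then have "v (-1) = 1"
    using abs_nonneg[of "-1"] by (metis abs_of_nonneg real_sqrt_abs2 real_sqrt_one)
  then have neg: "v (- a) = v a" for a using abs_mult[of "-1" a] by simp
  have sym: "v (a - b) = v (b - a)" for a b using neg[of "a - b"] by simp
  have ultra: "v (a - c) \<le> max (v (a - b)) (v (b - c))" for a b c
    using abs_add_le_max[of "a - b" "b - c"] by simp
  have "v (a - c) \<le> v (a - b) + v (b - c)" for a b c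
    using ultra[of a c b] abs_nonneg[of "a - b"] abs_nonneg[of "b - c"] by linarith
  then show ?thesis
    by unfold_locales (auto simp: abs_dist_def abs_nonneg abs_eq_0_iff ultra intro: sym)
qed

definition metric_balls :: "'a set \<Rightarrow> ('a \<Rightarrow> 'a \<Rightarrow> real) \<Rightarrow> 'a set set" where
  "metric_balls M d =
     {Metric_space.mball M d a r |a r. a \<in> M \<and> 0 < r} \<union>
     {Metric_space.mcball M d a r |a r. a \<in> M \<and> 0 < r}"

text \<open>Functions on \<open>X\<close> are represented by total functions that are \<open>undefined\<close> outside \<open>X\<close>,
  and functionals on the function space by total functions that are \<open>undefined\<close> outside that
  space. Hence HOL equality of functions and of measures is the mathematical one.\<close>

definition cont_funs ::
    "'x set \<Rightarrow> ('x \<Rightarrow> 'x \<Rightarrow> real) \<Rightarrow> ('k::field \<Rightarrow> real) \<Rightarrow> ('x \<Rightarrow> 'k) set" where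
  "cont_funs X d v =
     {f \<in> extensional X.
        continuous_map (Metric_space.mtopology X d) (Metric_space.mtopology UNIV (abs_dist v)) f}"

text \<open>The suprema below are taken in \<open>ennreal\<close>, the type of \<open>[0,\<infinity>]\<close>; in particular the supremum
  of an empty set is \<open>0\<close>.\<close>

definition sup_norm :: "'x set \<Rightarrow> ('k::field \<Rightarrow> real) \<Rightarrow> ('x \<Rightarrow> 'k) \<Rightarrow> ennreal" where
  "sup_norm X v f = (SUP x\<in>X. ennreal (v (f x)))"

definition dil ::
    "'x set \<Rightarrow> ('x \<Rightarrow> 'x \<Rightarrow> real) \<Rightarrow> ('k::field \<Rightarrow> real) \<Rightarrow> ('x \<Rightarrow> 'k) \<Rightarrow> ennreal" where
  "dil X d v f =
     (SUP (x, y)\<in>{(x, y). x \<in> X \<and> y \<in> X \<and> x \<noteq> y}. ennreal (v (f x - f y) / d x y))"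

definition BL_norm ::
    "'x set \<Rightarrow> ('x \<Rightarrow> 'x \<Rightarrow> real) \<Rightarrow> ('k::field \<Rightarrow> real) \<Rightarrow> ('x \<Rightarrow> 'k) \<Rightarrow> ennreal" where
  "BL_norm X d v f = max (sup_norm X v f) (dil X d v f)"

definition MEA ::
    "'x set \<Rightarrow> ('x \<Rightarrow> 'x \<Rightarrow> real) \<Rightarrow> ('k::field \<Rightarrow> real) \<Rightarrow> (('x \<Rightarrow> 'k) \<Rightarrow> 'k) set" where
  "MEA X d v =
     {\<mu> \<in> extensional (cont_funs X d v).
        (\<forall>f\<in>cont_funs X d v. \<forall>g\<in>cont_funs X d v. \<mu> (\<lambda>x\<in>X. f x + g x) = \<mu> f + \<mu> g) \<and>
        (\<forall>c. \<forall>f\<in>cont_funs X d v. \<mu> (\<lambda>x\<in>X. c * f x) = c * \<mu> f) \<and>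
        (\<exists>C\<ge>0. \<forall>f\<in>cont_funs X d v. ennreal (v (\<mu> f)) \<le> ennreal C * sup_norm X v f)}"

definition BL_dist ::
    "'x set \<Rightarrow> ('x \<Rightarrow> 'x \<Rightarrow> real) \<Rightarrow> ('k::field \<Rightarrow> real) \<Rightarrow>
     (('x \<Rightarrow> 'k) \<Rightarrow> 'k) \<Rightarrow> (('x \<Rightarrow> 'k) \<Rightarrow> 'k) \<Rightarrow> ennreal" where
  "BL_dist X d v \<mu>1 \<mu>2 =
     (SUP f\<in>{f \<in> cont_funs X d v. BL_norm X d v f \<le> 1}. ennreal (v (\<mu>1 f - \<mu>2 f)))"

end

theory Submission
  imports Defs
begin

text \<open>Symmetry and the strong triangle inequality of \<open>BL_dist\<close> are inherited pointwise from the
  absolute value, and finiteness holds because measures are bounded functionals and a test function,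
  that is a continuous function of bounded Lipschitz norm at most \<open>1\<close>, has sup norm at most \<open>1\<close>.
  The substance is that the test functions separate measures.

  They do because Lipschitz functions are dense among the continuous ones, and in the
  ultrametric setting no smoothing is needed to see this. By the strong triangle inequality the
  balls of radius \<open>\<delta>\<close> partition \<open>X\<close>; choosing a point in each and replacing a continuous \<open>f\<close> by its
  value at the chosen point gives a function \<open>g\<close> that is constant on these balls. Uniform
  continuity of \<open>f\<close>, which compactness provides, makes \<open>g\<close> close to \<open>f\<close>
  (\<open>step_function_approximates\<close>). Points in different balls are at distance at least \<open>\<delta>\<close>, so a
  bounded \<open>g\<close> is Lipschitz. Since \<open>K\<close> contains nonzero elements of arbitrarily small absolute
  value, a nonzero multiple of \<open>g\<close> is a test function (\<open>scaled_step_function_in_unit_ball\<close>). Two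
  measures that agree on test functions therefore agree on \<open>g\<close> by linearity, and on \<open>f\<close> by
  boundedness (\<open>measures_agreeing_on_unit_ball_eq\<close>).\<close>

section \<open>Valued fields\<close>

context nonarch_valued_field
begin

text \<open>Negation preserves the absolute value because \<open>abs_dist v\<close>, being a metric, is symmetric.\<close>

lemma abs_diff_commute: "v (a - b) = v (b - a)"
proof -
  interpret dist: nonarch_metric_space UNIV "abs_dist v"
    by (rule nonarch_metric_space_abs_dist)
  show ?thesis using dist.commute[of a b] by (simp add: abs_dist_def)
qed

lemma abs_diff_le_max: "v (a - b) \<le> max (v a) (v b)"
  using abs_add_le_max[of a "- b"] abs_diff_commute[of 0 b] by simp

lemma abs_diff_triangle: "v (a - c) \<le> max (v (a - b)) (v (b - c))"
  using abs_add_le_max[of "a - b" "b - c"] by simp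

lemma abs_zero: "v 0 = 0"
  by (simp add: abs_eq_0_iff)

lemma abs_one: "v 1 = 1"
  using abs_mult[of 1 1] abs_eq_0_iff[of 1] by simp

lemma abs_power: "v (a ^ n) = v a ^ n"
  by (induction n) (simp_all add: abs_mult abs_one)

text \<open>The open ball of radius \<open>1\<close> about \<open>0\<close> has a second point \<open>a\<close>, so that \<open>0 < v a < 1\<close>; the powers
  of \<open>a\<close> are nonzero and their absolute values tend to \<open>0\<close>.\<close>

lemma exists_small_abs:
  assumes "\<forall>B\<in>metric_balls UNIV (abs_dist v). \<exists>a\<in>B. \<exists>b\<in>B. a \<noteq> b" and "e > 0"
  obtains c where "c \<noteq> 0" "v c \<le> e"
proof -
  interpret dist: nonarch_metric_space UNIV "abs_dist v"
    by (rule nonarch_metric_space_abs_dist)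
  have "dist.mball 0 1 \<in> metric_balls UNIV (abs_dist v)"
    unfolding metric_balls_def by force
  then obtain a b where "a \<in> dist.mball 0 1" "b \<in> dist.mball 0 1" "a \<noteq> b"
    using assms(1) by blast
  then obtain a where a: "a \<in> dist.mball 0 1" "a \<noteq> 0"
    by metis
  then have "v a < 1"
    using abs_diff_commute[of 0 a] by (simp add: abs_dist_def)
  then obtain n where "v a ^ n < e"
    using real_arch_pow_inv \<open>e > 0\<close> by blast
  then show ?thesis
    using that[of "a ^ n"] a(2) by (simp add: abs_power)
qed

end

section \<open>Continuous functions and step functions\<close>

locale nonarch_fun_space = dom: nonarch_metric_space X d + val: nonarch_valued_field v
  for X :: "'x set" and d :: "'x \<Rightarrow> 'x \<Rightarrow> real" and v :: "'k::field \<Rightarrow> real"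
begin

lemma cont_funs_iff:
  "f \<in> cont_funs X d v \<longleftrightarrow> f \<in> extensional X \<and>
     (\<forall>x\<in>X. \<forall>\<epsilon>>0. \<exists>\<delta>>0. \<forall>y\<in>X. d x y < \<delta> \<longrightarrow> v (f x - f y) < \<epsilon>)"
proof -
  have "Metric_space UNIV (abs_dist v)"
    using val.nonarch_metric_space_abs_dist nonarch_metric_space_def by blast
  from dom.metric_continuous_map[OF this, of f] show ?thesis
    by (simp add: cont_funs_def abs_dist_def Ball_def imp_conjL)
qed

lemma cont_funs_uniformly_continuous:
  assumes "compact_space dom.mtopology" "f \<in> cont_funs X d v" "\<epsilon> > 0"
  obtains \<delta> where "\<delta> > 0" "\<And>x y. \<lbrakk>x \<in> X; y \<in> X; d x y < \<delta>\<rbrakk> \<Longrightarrow> v (f x - f y) < \<epsilon>"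
proof -
  interpret dist: nonarch_metric_space UNIV "abs_dist v"
    by (rule val.nonarch_metric_space_abs_dist)
  have "continuous_map dom.mtopology dist.mtopology f"
    using assms(2) by (simp add: cont_funs_def)
  then have "uniformly_continuous_map (metric (X, d)) (metric (UNIV, abs_dist v)) f"
    using continuous_imp_uniformly_continuous_map[of "metric (X, d)" "metric (UNIV, abs_dist v)" f]
      assms(1) by (simp add: mtopology_of_def)
  then have "\<exists>\<delta>>0. \<forall>x\<in>X. \<forall>y\<in>X. d y x < \<delta> \<longrightarrow> v (f y - f x) < \<epsilon>"
    using \<open>\<epsilon> > 0\<close> by (simp add: uniformly_continuous_map_def abs_dist_def)
  then show ?thesis using that by blast
qed

lemma cont_funs_bounded:
  assumes "compact_space dom.mtopology" "f \<in> cont_funs X d v"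
  obtains B where "B > 0" "\<And>x. x \<in> X \<Longrightarrow> v (f x) \<le> B"
proof -
  interpret dist: nonarch_metric_space UNIV "abs_dist v"
    by (rule val.nonarch_metric_space_abs_dist)
  have "compactin dist.mtopology (f ` X)"
    using image_compactin[of dom.mtopology X dist.mtopology f] assms
    by (simp add: compact_space_def cont_funs_def)
  \<comment> \<open>Including \<open>0\<close> turns the bound on the diameter into a bound on absolute values.\<close>
  then have "dist.mbounded (insert 0 (f ` X))"
    using dist.compactin_imp_mbounded dist.mbounded_insert by blast
  then obtain B where "B > 0" "\<forall>a\<in>insert 0 (f ` X). \<forall>b\<in>insert 0 (f ` X). abs_dist v a b \<le> B"
    unfolding dist.mbounded_alt_pos by blast
  then show ?thesis using that[of B] by (simp add: abs_dist_def)
qed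

lemma cont_funs_scale:
  assumes "f \<in> cont_funs X d v"
  shows "(\<lambda>x\<in>X. c * f x) \<in> cont_funs X d v"
proof (cases "c = 0")
  case True
  then show ?thesis by (auto simp: cont_funs_iff val.abs_zero intro: zero_less_one)
next
  case False
  then have "v c > 0" using val.abs_nonneg[of c] val.abs_eq_0_iff[of c] by linarith
  have "\<exists>\<delta>>0. \<forall>y\<in>X. d x y < \<delta> \<longrightarrow> v (c * f x - c * f y) < \<epsilon>" if "x \<in> X" "\<epsilon> > 0" for x \<epsilon>
  proof -
    have "\<epsilon> / v c > 0" using that \<open>v c > 0\<close> by simp
    then obtain \<delta> where "\<delta> > 0" "\<forall>y\<in>X. d x y < \<delta> \<longrightarrow> v (f x - f y) < \<epsilon> / v c"
      using assms \<open>x \<in> X\<close> unfolding cont_funs_iff by blast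
    then show ?thesis
      using \<open>v c > 0\<close>
      by (intro exI[of _ \<delta>])
         (simp add: val.abs_mult pos_less_divide_eq mult.commute flip: right_diff_distrib)
  qed
  then show ?thesis by (simp add: cont_funs_iff)
qed

lemma cont_funs_diff:
  assumes "f \<in> cont_funs X d v" "g \<in> cont_funs X d v"
  shows "(\<lambda>x\<in>X. f x - g x) \<in> cont_funs X d v"
proof -
  have "\<exists>\<delta>>0. \<forall>y\<in>X. d x y < \<delta> \<longrightarrow> v ((f x - g x) - (f y - g y)) < \<epsilon>"
    if x\<epsilon>: "x \<in> X" "\<epsilon> > 0" for x \<epsilon>
  proof -
    obtain \<delta>1 where "\<delta>1 > 0" and f: "\<forall>y\<in>X. d x y < \<delta>1 \<longrightarrow> v (f x - f y) < \<epsilon>"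
      using assms(1) x\<epsilon> unfolding cont_funs_iff by blast
    obtain \<delta>2 where "\<delta>2 > 0" and g: "\<forall>y\<in>X. d x y < \<delta>2 \<longrightarrow> v (g x - g y) < \<epsilon>"
      using assms(2) x\<epsilon> unfolding cont_funs_iff by blast
    have "v ((f x - g x) - (f y - g y)) < \<epsilon>" if "y \<in> X" "d x y < min \<delta>1 \<delta>2" for y
    proof -
      have "v ((f x - g x) - (f y - g y)) \<le> max (v (f x - f y)) (v (g x - g y))"
        using val.abs_diff_le_max[of "f x - f y" "g x - g y"] by (simp add: algebra_simps)
      also have "\<dots> < \<epsilon>" using f g that by simp
      finally show ?thesis .
    qed
    moreover have "min \<delta>1 \<delta>2 > 0" using \<open>\<delta>1 > 0\<close> \<open>\<delta>2 > 0\<close> by simp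
    ultimately show ?thesis by blast
  qed
  then show ?thesis by (simp add: cont_funs_iff)
qed

text \<open>The values of the step function of \<open>f\<close> at scale \<open>\<delta>\<close> are samples of \<open>f\<close>, one from each
  \<open>\<delta>\<close>-ball; the choice depends only on the ball, so all its points share the sample.\<close>

definition step_function :: "real \<Rightarrow> ('x \<Rightarrow> 'k) \<Rightarrow> 'x \<Rightarrow> 'k" where
  "step_function \<delta> f = (\<lambda>x\<in>X. f (SOME y. y \<in> dom.mball x \<delta>))"

text \<open>Two \<open>\<delta>\<close>-balls with centres less than \<open>\<delta>\<close> apart coincide.\<close>

lemma step_function_locally_constant:
  assumes "x \<in> X" "y \<in> X" "d x y < \<delta>"
  shows "step_function \<delta> f x = step_function \<delta> f y"
proof -
  have "d x z < \<delta> \<longleftrightarrow> d y z < \<delta>" if "z \<in> X" for z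
    using dom.strong_triangle[of x y z] dom.strong_triangle[of y x z] dom.commute[of x y] assms that
    by linarith
  then have "dom.mball x \<delta> = dom.mball y \<delta>"
    using assms by auto
  then show ?thesis using assms by (simp add: step_function_def del: dom.in_mball)
qed

lemma step_function_in_cont_funs:
  assumes "\<delta> > 0"
  shows "step_function \<delta> f \<in> cont_funs X d v"
proof -
  have "v (step_function \<delta> f x - step_function \<delta> f y) = 0"
    if "x \<in> X" "y \<in> X" "d x y < \<delta>" for x y
    using step_function_locally_constant[OF that] by (simp add: val.abs_eq_0_iff)
  moreover have "step_function \<delta> f \<in> extensional X"
    by (simp add: step_function_def)
  ultimately show ?thesis
    unfolding cont_funs_iff using assms by metis
qed

lemma step_function_sample:
  assumes "x \<in> X" "\<delta> > 0"
  obtains y where "y \<in> X" "d x y < \<delta>" "step_function \<delta> f x = f y"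
proof -
  have "x \<in> dom.mball x \<delta>" using assms by simp
  then have "(SOME y. y \<in> dom.mball x \<delta>) \<in> dom.mball x \<delta>" by (rule someI)
  then show ?thesis
    using that[of "SOME y. y \<in> dom.mball x \<delta>"] assms(1)
    by (simp only: step_function_def dom.in_mball) simp
qed

lemma step_function_approximates:
  assumes "compact_space dom.mtopology" "f \<in> cont_funs X d v" "\<epsilon> > 0"
  obtains \<delta> where "\<delta> > 0" "\<And>x. x \<in> X \<Longrightarrow> v (f x - step_function \<delta> f x) \<le> \<epsilon>"
proof -
  obtain \<delta> where \<delta>: "\<delta> > 0" "\<And>x y. \<lbrakk>x \<in> X; y \<in> X; d x y < \<delta>\<rbrakk> \<Longrightarrow> v (f x - f y) < \<epsilon>"
    using cont_funs_uniformly_continuous[OF assms] by blast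
  then have "v (f x - step_function \<delta> f x) \<le> \<epsilon>" if "x \<in> X" for x
    using step_function_sample[OF that \<delta>(1)] that by (metis less_imp_le)
  then show ?thesis using that \<delta>(1) by blast
qed

section \<open>The unit ball of the bounded Lipschitz norm\<close>

lemma sup_norm_le_iff:
  assumes "0 \<le> r"
  shows "sup_norm X v f \<le> ennreal r \<longleftrightarrow> (\<forall>x\<in>X. v (f x) \<le> r)"
  using assms by (simp add: sup_norm_def SUP_le_iff ennreal_le_iff)

lemma BL_norm_le_1_iff:
  "BL_norm X d v f \<le> 1 \<longleftrightarrow>
     (\<forall>x\<in>X. v (f x) \<le> 1) \<and> (\<forall>x\<in>X. \<forall>y\<in>X. v (f x - f y) \<le> d x y)"
proof -
  have "v (f x - f y) / d x y \<le> 1 \<longleftrightarrow> v (f x - f y) \<le> d x y" if "x \<in> X" "y \<in> X" "x \<noteq> y" for x y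
    using dom.mdist_pos_less[OF that(3,1,2)] by (simp add: pos_divide_le_eq)
  moreover have "v (f x - f y) \<le> d x y" if "x = y" for x y
    using that val.abs_zero by simp
  moreover have "dil X d v f \<le> 1 \<longleftrightarrow> (\<forall>x\<in>X. \<forall>y\<in>X. x \<noteq> y \<longrightarrow> v (f x - f y) / d x y \<le> 1)"
    by (auto simp: dil_def SUP_le_iff)
  ultimately have "dil X d v f \<le> 1 \<longleftrightarrow> (\<forall>x\<in>X. \<forall>y\<in>X. v (f x - f y) \<le> d x y)"
    by blast
  then show ?thesis
    using sup_norm_le_iff[of 1 f] by (simp add: BL_norm_def)
qed

text \<open>If \<open>f\<close> is bounded by \<open>B\<close>, its step function at scale \<open>\<delta>\<close> is bounded by \<open>B\<close> and has Lipschitz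
  constant at most \<open>B / \<delta>\<close>. A factor \<open>c\<close> of absolute value at most \<open>min 1 \<delta> / B\<close> compensates for both.\<close>

lemma scaled_step_function_in_unit_ball:
  assumes "\<delta> > 0" "B > 0" "\<And>x. x \<in> X \<Longrightarrow> v (f x) \<le> B" "v c \<le> min 1 \<delta> / B"
  shows "BL_norm X d v (\<lambda>x\<in>X. c * step_function \<delta> f x) \<le> 1"
proof -
  let ?g = "step_function \<delta> f"
  have g: "v (?g x) \<le> B" if "x \<in> X" for x
    using step_function_sample[OF that assms(1), of f] assms(3) by metis
  have cB: "v (c * a) \<le> min 1 \<delta>" if "v a \<le> B" for a
  proof -
    have "v (c * a) \<le> (min 1 \<delta> / B) * B"
      using that assms(4) assms(1,2) val.abs_nonneg unfolding val.abs_mult by (intro mult_mono) auto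
    then show ?thesis using \<open>B > 0\<close> by simp
  qed
  have "v (c * ?g x - c * ?g y) \<le> d x y" if "x \<in> X" "y \<in> X" for x y
  proof (cases "d x y < \<delta>")
    case True
    then show ?thesis
      using step_function_locally_constant[OF that True, of f] val.abs_zero by simp
  next
    case False
    have "v (?g x - ?g y) \<le> B"
      using val.abs_diff_le_max[of "?g x" "?g y"] g[OF that(1)] g[OF that(2)] by linarith
    from cB[OF this] False show ?thesis by (simp add: right_diff_distrib)
  qed
  moreover have "v (c * ?g x) \<le> 1" if "x \<in> X" for x
    using cB[OF g[OF that]] by simp
  ultimately show ?thesis by (simp add: BL_norm_le_1_iff)
qed

section \<open>Measures\<close>

lemma MEA_add:
  assumes "\<mu> \<in> MEA X d v" "f \<in> cont_funs X d v" "g \<in> cont_funs X d v"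
  shows "\<mu> (\<lambda>x\<in>X. f x + g x) = \<mu> f + \<mu> g"
proof -
  have "\<forall>f\<in>cont_funs X d v. \<forall>g\<in>cont_funs X d v. \<mu> (\<lambda>x\<in>X. f x + g x) = \<mu> f + \<mu> g"
    using assms(1) unfolding MEA_def mem_Collect_eq by (elim conjE)
  from bspec[OF bspec[OF this assms(2)] assms(3)] show ?thesis .
qed

lemma MEA_diff:
  assumes "\<mu> \<in> MEA X d v" "f \<in> cont_funs X d v" "g \<in> cont_funs X d v"
  shows "\<mu> (\<lambda>x\<in>X. f x - g x) = \<mu> f - \<mu> g"
proof -
  \<comment> \<open>Only additivity is available, so \<open>f\<close> is written as the sum of \<open>f - g\<close> and \<open>g\<close>. The two sides
    agree outside \<open>X\<close> because \<open>f\<close> is extensional.\<close>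
  have "(\<lambda>x\<in>X. (\<lambda>x\<in>X. f x - g x) x + g x) = f"
    using assms(2) by (auto simp: cont_funs_def extensional_def fun_eq_iff)
  then have "\<mu> f = \<mu> (\<lambda>x\<in>X. f x - g x) + \<mu> g"
    using MEA_add[OF assms(1) cont_funs_diff[OF assms(2,3)] assms(3)] by simp
  then show ?thesis by simp
qed

lemma MEA_scale:
  assumes "\<mu> \<in> MEA X d v" "f \<in> cont_funs X d v"
  shows "\<mu> (\<lambda>x\<in>X. c * f x) = c * \<mu> f"
proof -
  have "\<forall>c. \<forall>f\<in>cont_funs X d v. \<mu> (\<lambda>x\<in>X. c * f x) = c * \<mu> f"
    using assms(1) unfolding MEA_def mem_Collect_eq by (elim conjE)
  from bspec[OF spec[OF this] assms(2)] show ?thesis .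
qed

lemma MEA_bounded:
  assumes "\<mu> \<in> MEA X d v"
  obtains C where "C \<ge> 0"
    "\<And>f r. \<lbrakk>f \<in> cont_funs X d v; r \<ge> 0; \<And>x. x \<in> X \<Longrightarrow> v (f x) \<le> r\<rbrakk> \<Longrightarrow> v (\<mu> f) \<le> C * r"
proof -
  obtain C where C: "C \<ge> 0" "\<forall>f\<in>cont_funs X d v. ennreal (v (\<mu> f)) \<le> ennreal C * sup_norm X v f"
    using assms unfolding MEA_def mem_Collect_eq by (elim conjE exE)
  have "v (\<mu> f) \<le> C * r"
    if "f \<in> cont_funs X d v" "r \<ge> 0" "\<And>x. x \<in> X \<Longrightarrow> v (f x) \<le> r" for f r
  proof -
    have "ennreal (v (\<mu> f)) \<le> ennreal C * sup_norm X v f"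
      using C(2) that(1) by blast
    also have "\<dots> \<le> ennreal C * ennreal r"
      using that(2,3) sup_norm_le_iff by (intro mult_left_mono) auto
    also have "\<dots> = ennreal (C * r)"
      using C(1) by (simp add: ennreal_mult')
    finally show ?thesis
      using C(1) that(2) by (simp add: ennreal_le_iff)
  qed
  then show ?thesis using that C(1) by blast
qed

text \<open>Density of step functions: on the step function \<open>g\<close> of \<open>f\<close> the two measures agree, so their
  difference at \<open>f\<close> is their difference at \<open>f - g\<close>, which is as small as desired.\<close>

lemma measures_agreeing_on_unit_ball_eq:
  assumes compact: "compact_space dom.mtopology"
    and small: "\<And>e. e > 0 \<Longrightarrow> \<exists>c. c \<noteq> 0 \<and> v c \<le> e"
    and \<mu>: "\<mu>1 \<in> MEA X d v" "\<mu>2 \<in> MEA X d v"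
    and agree: "\<And>f. \<lbrakk>f \<in> cont_funs X d v; BL_norm X d v f \<le> 1\<rbrakk> \<Longrightarrow> \<mu>1 f = \<mu>2 f"
  shows "\<mu>1 = \<mu>2"
proof (rule extensionalityI)
  show "\<mu>1 \<in> extensional (cont_funs X d v)" "\<mu>2 \<in> extensional (cont_funs X d v)"
    using \<mu> by (simp_all add: MEA_def)
next
  fix f assume f: "f \<in> cont_funs X d v"
  obtain B where B: "B > 0" "\<And>x. x \<in> X \<Longrightarrow> v (f x) \<le> B"
    using cont_funs_bounded[OF compact f] by blast
  obtain C1 where "C1 \<ge> 0" and C1: "\<And>f r. \<lbrakk>f \<in> cont_funs X d v; r \<ge> 0; \<And>x. x \<in> X \<Longrightarrow> v (f x) \<le> r\<rbrakk>
      \<Longrightarrow> v (\<mu>1 f) \<le> C1 * r"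
    using MEA_bounded[OF \<mu>(1)] by blast
  obtain C2 where C2: "\<And>f r. \<lbrakk>f \<in> cont_funs X d v; r \<ge> 0; \<And>x. x \<in> X \<Longrightarrow> v (f x) \<le> r\<rbrakk>
      \<Longrightarrow> v (\<mu>2 f) \<le> C2 * r"
    using MEA_bounded[OF \<mu>(2)] by blast
  have "v (\<mu>1 f - \<mu>2 f) \<le> e" if "e > 0" for e
  proof -
    \<comment> \<open>Adding \<open>1\<close> keeps the denominator positive when both bounds are \<open>0\<close>.\<close>
    define \<epsilon> where "\<epsilon> = e / (max C1 C2 + 1)"
    have "\<epsilon> > 0" using \<open>e > 0\<close> \<open>C1 \<ge> 0\<close> by (simp add: \<epsilon>_def)
    then obtain \<delta> where "\<delta> > 0" and \<delta>: "\<And>x. x \<in> X \<Longrightarrow> v (f x - step_function \<delta> f x) \<le> \<epsilon>"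
      using step_function_approximates[OF compact f] by blast
    define g where "g = step_function \<delta> f"
    have g: "g \<in> cont_funs X d v"
      unfolding g_def using \<open>\<delta> > 0\<close> by (rule step_function_in_cont_funs)
    obtain c where "c \<noteq> 0" "v c \<le> min 1 \<delta> / B"
      using small[of "min 1 \<delta> / B"] \<open>\<delta> > 0\<close> B(1) by auto
    then have "c * \<mu>1 g = c * \<mu>2 g"
      using agree[OF cont_funs_scale[OF g, of c]] MEA_scale[OF \<mu>(1) g] MEA_scale[OF \<mu>(2) g]
        scaled_step_function_in_unit_ball[OF \<open>\<delta> > 0\<close> B] by (simp add: g_def)
    then have "\<mu>1 f - \<mu>2 f = \<mu>1 (\<lambda>x\<in>X. f x - g x) - \<mu>2 (\<lambda>x\<in>X. f x - g x)"
      using \<open>c \<noteq> 0\<close> MEA_diff[OF \<mu>(1) f g] MEA_diff[OF \<mu>(2) f g] by simp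
    then have "v (\<mu>1 f - \<mu>2 f) \<le> max (v (\<mu>1 (\<lambda>x\<in>X. f x - g x))) (v (\<mu>2 (\<lambda>x\<in>X. f x - g x)))"
      using val.abs_diff_le_max by simp
    also have "\<dots> \<le> max (C1 * \<epsilon>) (C2 * \<epsilon>)"
      using C1[OF cont_funs_diff[OF f g], of \<epsilon>] C2[OF cont_funs_diff[OF f g], of \<epsilon>] \<delta> \<open>\<epsilon> > 0\<close>
      by (intro max.mono) (simp_all add: g_def)
    also have "\<dots> \<le> (max C1 C2 + 1) * \<epsilon>"
      using \<open>\<epsilon> > 0\<close> by (auto intro!: mult_right_mono)
    also have "\<dots> = e"
      using \<open>C1 \<ge> 0\<close> by (simp add: \<epsilon>_def)
    finally show ?thesis .
  qed
  then have "v (\<mu>1 f - \<mu>2 f) \<le> 0"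
    by (rule field_le_epsilon) simp
  then show "\<mu>1 f = \<mu>2 f"
    using val.abs_nonneg[of "\<mu>1 f - \<mu>2 f"] val.abs_eq_0_iff[of "\<mu>1 f - \<mu>2 f"] by simp
qed

section \<open>The bounded Lipschitz distance\<close>

lemma BL_dist_le_iff:
  assumes "0 \<le> r"
  shows "BL_dist X d v \<mu>1 \<mu>2 \<le> ennreal r \<longleftrightarrow>
    (\<forall>f. f \<in> cont_funs X d v \<longrightarrow> BL_norm X d v f \<le> 1 \<longrightarrow> v (\<mu>1 f - \<mu>2 f) \<le> r)"
  unfolding BL_dist_def SUP_le_iff ennreal_le_iff[OF assms] by blast

lemma BL_dist_finite:
  assumes "\<mu>1 \<in> MEA X d v" "\<mu>2 \<in> MEA X d v"
  shows "BL_dist X d v \<mu>1 \<mu>2 < \<infinity>"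
proof -
  obtain C1 where "C1 \<ge> 0" and C1: "\<And>f r. \<lbrakk>f \<in> cont_funs X d v; r \<ge> 0; \<And>x. x \<in> X \<Longrightarrow> v (f x) \<le> r\<rbrakk>
      \<Longrightarrow> v (\<mu>1 f) \<le> C1 * r"
    using MEA_bounded[OF assms(1)] by blast
  obtain C2 where C2: "\<And>f r. \<lbrakk>f \<in> cont_funs X d v; r \<ge> 0; \<And>x. x \<in> X \<Longrightarrow> v (f x) \<le> r\<rbrakk>
      \<Longrightarrow> v (\<mu>2 f) \<le> C2 * r"
    using MEA_bounded[OF assms(2)] by blast
  have "v (\<mu>1 f - \<mu>2 f) \<le> max C1 C2" if "f \<in> cont_funs X d v" "BL_norm X d v f \<le> 1" for f
    using val.abs_diff_le_max[of "\<mu>1 f" "\<mu>2 f"] C1[OF that(1), of 1] C2[OF that(1), of 1] that(2)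
    by (auto simp: BL_norm_le_1_iff)
  then have "BL_dist X d v \<mu>1 \<mu>2 \<le> ennreal (max C1 C2)"
    using \<open>C1 \<ge> 0\<close> by (subst BL_dist_le_iff) auto
  then show ?thesis
    using le_less_trans[OF _ ennreal_less_top] by (simp add: infinity_ennreal_def)
qed

lemma BL_dist_commute: "BL_dist X d v \<mu>1 \<mu>2 = BL_dist X d v \<mu>2 \<mu>1"
  by (simp add: BL_dist_def val.abs_diff_commute)

lemma BL_dist_strong_triangle:
  "BL_dist X d v \<mu>1 \<mu>3 \<le> max (BL_dist X d v \<mu>1 \<mu>2) (BL_dist X d v \<mu>2 \<mu>3)"
  unfolding BL_dist_def[of _ _ _ \<mu>1 \<mu>3]
proof (rule SUP_least)
  fix f assume f: "f \<in> {f \<in> cont_funs X d v. BL_norm X d v f \<le> 1}"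
  have "ennreal (v (\<mu>1 f - \<mu>3 f)) \<le> ennreal (max (v (\<mu>1 f - \<mu>2 f)) (v (\<mu>2 f - \<mu>3 f)))"
    by (intro ennreal_leI val.abs_diff_triangle)
  also have "\<dots> = max (ennreal (v (\<mu>1 f - \<mu>2 f))) (ennreal (v (\<mu>2 f - \<mu>3 f)))"
    by (simp add: max_def ennreal_le_iff val.abs_nonneg)
  also have "\<dots> \<le> max (BL_dist X d v \<mu>1 \<mu>2) (BL_dist X d v \<mu>2 \<mu>3)"
    using f unfolding BL_dist_def by (intro max.mono SUP_upper)
  finally show "ennreal (v (\<mu>1 f - \<mu>3 f)) \<le> max (BL_dist X d v \<mu>1 \<mu>2) (BL_dist X d v \<mu>2 \<mu>3)" .
qed

lemma BL_dist_eq_0_iff: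
  assumes "compact_space dom.mtopology"
    and "\<And>e. e > 0 \<Longrightarrow> \<exists>c. c \<noteq> 0 \<and> v c \<le> e"
    and "\<mu>1 \<in> MEA X d v" "\<mu>2 \<in> MEA X d v"
  shows "BL_dist X d v \<mu>1 \<mu>2 = 0 \<longleftrightarrow> \<mu>1 = \<mu>2"
proof
  assume "BL_dist X d v \<mu>1 \<mu>2 = 0"
  then have "v (\<mu>1 f - \<mu>2 f) \<le> 0" if "f \<in> cont_funs X d v" "BL_norm X d v f \<le> 1" for f
    using BL_dist_le_iff[of 0 \<mu>1 \<mu>2] that by simp
  then have "\<mu>1 f = \<mu>2 f" if "f \<in> cont_funs X d v" "BL_norm X d v f \<le> 1" for f
    using that val.abs_nonneg val.abs_eq_0_iff by (metis antisym eq_iff_diff_eq_0)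
  then show "\<mu>1 = \<mu>2"
    using measures_agreeing_on_unit_ball_eq[OF assms] by blast
next
  assume "\<mu>1 = \<mu>2"
  then show "BL_dist X d v \<mu>1 \<mu>2 = 0"
    using BL_dist_le_iff[of 0 \<mu>1 \<mu>2] val.abs_zero by simp
qed

end

theorem theorem5p2:
  fixes X :: "'x set" and d :: "'x \<Rightarrow> 'x \<Rightarrow> real" and v :: "'k::field \<Rightarrow> real"
  assumes "nonarch_metric_space X d"
    and "compact_space (Metric_space.mtopology X d)"
    and "nonarch_valued_field v"
    and "Metric_space.mcomplete UNIV (abs_dist v)"
    and "\<forall>B\<in>metric_balls X d. \<exists>x\<in>B. \<exists>y\<in>B. x \<noteq> y"
    and "\<forall>B\<in>metric_balls UNIV (abs_dist v). \<exists>a\<in>B. \<exists>b\<in>B. a \<noteq> b"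
  shows "(\<forall>\<mu>1\<in>MEA X d v. \<forall>\<mu>2\<in>MEA X d v. BL_dist X d v \<mu>1 \<mu>2 < \<infinity>) \<and>
    nonarch_metric_space (MEA X d v) (\<lambda>\<mu>1 \<mu>2. enn2real (BL_dist X d v \<mu>1 \<mu>2))"
proof -
  interpret nonarch_fun_space X d v
    using assms(1,3) by (rule nonarch_fun_space.intro)
  let ?D = "BL_dist X d v" and ?D' = "\<lambda>\<mu>1 \<mu>2. enn2real (BL_dist X d v \<mu>1 \<mu>2)"
  have small: "\<exists>c. c \<noteq> 0 \<and> v c \<le> e" if "e > 0" for e
    using val.exists_small_abs[OF assms(6) that] by blast
  have zero: "?D' \<mu>1 \<mu>2 = 0 \<longleftrightarrow> \<mu>1 = \<mu>2" if "\<mu>1 \<in> MEA X d v" "\<mu>2 \<in> MEA X d v" for \<mu>1 \<mu>2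
    using BL_dist_eq_0_iff[OF assms(2) small that] BL_dist_finite[OF that]
    by (auto simp: enn2real_eq_0_iff)
  have ultra: "?D' \<mu>1 \<mu>3 \<le> max (?D' \<mu>1 \<mu>2) (?D' \<mu>2 \<mu>3)"
    if "\<mu>1 \<in> MEA X d v" "\<mu>2 \<in> MEA X d v" "\<mu>3 \<in> MEA X d v" for \<mu>1 \<mu>2 \<mu>3
  proof -
    have "?D' \<mu>1 \<mu>3 \<le> enn2real (max (?D \<mu>1 \<mu>2) (?D \<mu>2 \<mu>3))"
      using BL_dist_strong_triangle BL_dist_finite[OF that(1,2)] BL_dist_finite[OF that(2,3)]
      by (intro enn2real_mono) (auto simp: infinity_ennreal_def)
    then show ?thesis by (simp add: max_def split: if_splits)
  qed
  have "Metric_space (MEA X d v) ?D'"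
  proof
    fix \<mu>1 \<mu>2 \<mu>3 assume "\<mu>1 \<in> MEA X d v" "\<mu>2 \<in> MEA X d v" "\<mu>3 \<in> MEA X d v"
    then have "?D' \<mu>1 \<mu>3 \<le> max (?D' \<mu>1 \<mu>2) (?D' \<mu>2 \<mu>3)" by (rule ultra)
    also have "\<dots> \<le> ?D' \<mu>1 \<mu>2 + ?D' \<mu>2 \<mu>3" by simp
    finally show "?D' \<mu>1 \<mu>3 \<le> ?D' \<mu>1 \<mu>2 + ?D' \<mu>2 \<mu>3" .
  qed (simp_all add: zero BL_dist_commute)
  then have "nonarch_metric_space (MEA X d v) ?D'"
    by (intro nonarch_metric_space.intro nonarch_metric_space_axioms.intro ultra)
  then show ?thesis using BL_dist_finite by blast
qed

end
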